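(* There exist a rational polyhedron $\mathcal{P} \subseteq \mathbb{R}^3$ and a cubic polynomial $f \colon \mathbb{R}^3 \to \mathbb{R}$ with rational coefficients such that $f$ is unbounded below on $\mathcal{P} \cap \mathbb{Z}^3$, and for every ray $\mathcal{R}(y,d)$ of $\mathcal{P}$, $f$ is bounded below on $\mathcal{R}(y,d) \cap \mathbb{Z}^3$.
   Context: A polyhedron is a set $\mathcal{P} = \{x \in \mathbb{R}^n : Ax \le b\}$ with $A \in \mathbb{R}^{m \times n}$, $b \in \mathbb{R}^m$; it is rational if $A \in \mathbb{Q}^{m\times n}$ and $b \in \mathbb{Q}^m$. A ray in $\mathbb{R}^n$ is a set $\mathcal{R}(y,d) = \{y + \lambda d : \lambda \ge 0\}$ with $y \in \mathbb{R}^n$ and nonzero $d \in \mathbb{R}^n$. A ray of $\mathcal{P}$ is a ray fully contained in $\mathcal{P}$. A cubic polynomial is a polynomial of degree three. A function $f$ is unbounded below on a set $S$ if for every $c \in \mathbb{R}$ there is $x \in S$ with $f(x) < c$, and bounded below on $S$ otherwise (in particular, bounded below on the empty set). *)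

theory Defs
  imports "HOL-Analysis.Analysis" "HOL-Library.Poly_Mapping"
begin

text \<open>
  The system \<open>A x \<le> b\<close>, with the \<open>m\<close> rows of \<open>A\<close> and the entries of \<open>b\<close> indexed by \<open>{..<m}\<close>:
  the number of rows is existentially quantified, so it cannot be an index type.
  Values of \<open>A\<close> and \<open>b\<close> at indices \<open>\<ge> m\<close> are ignored.
\<close>

definition rational_polyhedron :: "(real ^ 'n) set \<Rightarrow> bool" where
  "rational_polyhedron P \<longleftrightarrow>
     (\<exists>(m::nat) (A :: nat \<Rightarrow> real ^ 'n) (b :: nat \<Rightarrow> real).
        (\<forall>i<m. (\<forall>j. A i $ j \<in> \<rat>) \<and> b i \<in> \<rat>) \<and>
        P = {x. \<forall>i<m. (\<Sum>j\<in>UNIV. A i $ j * x $ j) \<le> b i})"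

definition ray :: "real ^ 'n \<Rightarrow> real ^ 'n \<Rightarrow> (real ^ 'n) set" where
  "ray y d = {y + t *\<^sub>R d | t. t \<ge> 0}"

definition integer_points :: "(real ^ 'n) set" where
  "integer_points = {x. \<forall>i. x $ i \<in> \<int>}"

text \<open>
  A polynomial in variables indexed by \<open>'n\<close> maps each monomial (its exponent vector, of type
  \<open>'n \<Rightarrow>\<^sub>0 nat\<close>) to its coefficient, with finite support.
\<close>

type_synonym 'n real_mpoly = "('n \<Rightarrow>\<^sub>0 nat) \<Rightarrow>\<^sub>0 real"

definition mpoly_eval :: "'n::finite real_mpoly \<Rightarrow> real ^ 'n \<Rightarrow> real" where
  "mpoly_eval p x =
     (\<Sum>e \<in> Poly_Mapping.keys p. Poly_Mapping.lookup p e * (\<Prod>i\<in>UNIV. x $ i ^ Poly_Mapping.lookup e i))"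

text \<open>The inserted \<open>0\<close> gives the zero polynomial degree \<open>0\<close>.\<close>

definition mpoly_total_degree :: "'n::finite real_mpoly \<Rightarrow> nat" where
  "mpoly_total_degree p =
     Max (insert 0 ((\<lambda>e. \<Sum>i\<in>UNIV. Poly_Mapping.lookup e i) ` Poly_Mapping.keys p))"

definition rational_coeffs :: "'n real_mpoly \<Rightarrow> bool" where
  "rational_coeffs p \<longleftrightarrow> (\<forall>e. Poly_Mapping.lookup p e \<in> \<rat>)"

lemma not_bdd_below_image_iff:
  fixes f :: "'a \<Rightarrow> real"
  shows "\<not> bdd_below (f ` S) \<longleftrightarrow> (\<forall>c. \<exists>x\<in>S. f x < c)"
  by (auto simp: bdd_below_def not_le)

end

theory Submission
  imports Defs
begin

text \<open>
  The example is the nonnegative orthant together with \<open>f = N - x\<close>, where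
  \<open>N(x,y,z) = x\<^sup>3 + 2y\<^sup>3 + 4z\<^sup>3 - 6xyz\<close> is the norm of \<open>x + y\<theta> + z\<theta>\<^sup>2\<close> over the rationals,
  with \<open>\<theta>\<close> the real cube root of 2.

  The field generated by \<open>\<theta>\<close> has one real and one pair of complex conjugate embeddings, so over
  the reals \<open>N\<close> is a linear form that is positive on the orthant times a positive semidefinite
  quadratic form. Hence \<open>N \<ge> 0\<close> on the orthant, and its only zeros there lie on one line, of
  irrational direction \<open>(\<theta>\<^sup>2, \<theta>, 1)\<close>; no nonzero integer vector is a zero of \<open>N\<close>
  (\<open>norm_form_pos\<close>). A ray of the orthant with at least two integer points has the direction of
  an integer vector, so along it \<open>f\<close> is a cubic polynomial in the parameter with positive
  leading coefficient and is bounded below (\<open>bdd_below_cubic\<close>). A ray with at most one integer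
  point is harmless.

  On the other hand, the integer points of the orthant can follow the irrational direction: the
  powers of the unit \<open>1 + \<theta> + \<theta>\<^sup>2\<close> all have norm 1, while their coordinates tend to infinity
  (\<open>norm_one_unbounded\<close>). There \<open>f = 1 - x\<close> tends to minus infinity.
\<close>

section \<open>The norm form\<close>

definition norm_form :: "'a::comm_ring_1 \<Rightarrow> 'a \<Rightarrow> 'a \<Rightarrow> 'a" where
  "norm_form x y z = x ^ 3 + 2 * y ^ 3 + 4 * z ^ 3 - 6 * x * y * z"

lemma norm_form_of_int:
  "norm_form (of_int a) (of_int b) (of_int c) = of_int (norm_form a b c)"
  by (simp add: norm_form_def)

lemma norm_form_scale: "norm_form (s * x) (s * y) (s * z) = s ^ 3 * norm_form x y z"
  by (simp add: norm_form_def algebra_simps power3_eq_cube)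

text \<open>
  This is the inequality between the arithmetic and geometric means for the cubes of
  \<open>x\<close>, \<open>y\<theta>\<close> and \<open>z\<theta>\<^sup>2\<close>.
\<close>

lemma norm_form_nonneg:
  fixes x y z :: real
  assumes "x \<ge> 0" "y \<ge> 0" "z \<ge> 0"
  shows "norm_form x y z \<ge> 0"
proof -
  define r :: real where "r = root 3 2"
  have r: "r > 0" "r ^ 3 = 2" by (simp_all add: r_def)
  define b c where "b = y * r" and "c = z * r ^ 2"
  have "b ^ 3 = y ^ 3 * r ^ 3" by (simp add: b_def power_mult_distrib)
  moreover have "c ^ 3 = z ^ 3 * (r ^ 3) ^ 2"
    by (simp add: c_def power_mult_distrib flip: power_mult)
  moreover have "x * b * c = x * y * z * r ^ 3"
    by (simp add: b_def c_def power2_eq_square power3_eq_cube)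
  ultimately have "norm_form x y z = x ^ 3 + b ^ 3 + c ^ 3 - 3 * (x * b * c)"
    by (simp only: norm_form_def r) simp
  also have "\<dots> = (x + b + c) * ((x - b) ^ 2 + (b - c) ^ 2 + (x - c) ^ 2) / 2"
    by (simp add: algebra_simps power2_eq_square power3_eq_cube)
  also have "\<dots> \<ge> 0"
    using assms r by (simp add: b_def c_def)
  finally show ?thesis .
qed

text \<open>
  Infinite descent at the prime 2: the equation forces \<open>a\<close>, then \<open>b\<close>, then \<open>c\<close> to be even,
  and half of a zero is again a zero.
\<close>

lemma norm_form_int_eq_0:
  fixes a b c :: int
  assumes "norm_form a b c = 0"
  shows "a = 0 \<and> b = 0 \<and> c = 0"
  using assms
proof (induction "nat (\<bar>a\<bar> + \<bar>b\<bar> + \<bar>c\<bar>)" arbitrary: a b c rule: less_induct)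
  case less
  have eq: "a ^ 3 + 2 * b ^ 3 + 4 * c ^ 3 = 6 * a * b * c"
    using less.prems by (simp add: norm_form_def)
  have "a ^ 3 = 2 * (3 * a * b * c - b ^ 3 - 2 * c ^ 3)" using eq by simp
  then have "even (a ^ 3)" by simp
  then obtain a' where a: "a = 2 * a'" by (auto elim: evenE)
  have "b ^ 3 = 2 * (3 * a' * b * c - 2 * a' ^ 3 - c ^ 3)" using eq by (simp add: a)
  then have "even (b ^ 3)" by simp
  then obtain b' where b: "b = 2 * b'" by (auto elim: evenE)
  have "c ^ 3 = 2 * (3 * a' * b' * c - a' ^ 3 - 2 * b' ^ 3)" using eq by (simp add: a b)
  then have "even (c ^ 3)" by simp
  then obtain c' where c: "c = 2 * c'" by (auto elim: evenE)
  have "8 * norm_form a' b' c' = 0"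
    using eq by (simp add: norm_form_def a b c)
  then have zero: "norm_form a' b' c' = 0" by simp
  show ?case
  proof (rule ccontr)
    assume nonzero: "\<not> (a = 0 \<and> b = 0 \<and> c = 0)"
    then have "nat (\<bar>a'\<bar> + \<bar>b'\<bar> + \<bar>c'\<bar>) < nat (\<bar>a\<bar> + \<bar>b\<bar> + \<bar>c\<bar>)"
      by (auto simp: a b c)
    from less.hyps[OF this zero] show False
      using nonzero by (simp add: a b c)
  qed
qed

lemma norm_form_pos:
  fixes x y z :: real
  assumes "x \<in> \<int>" "y \<in> \<int>" "z \<in> \<int>" "x \<ge> 0" "y \<ge> 0" "z \<ge> 0"
    and nz: "x \<noteq> 0 \<or> y \<noteq> 0 \<or> z \<noteq> 0"
  shows "norm_form x y z > 0"
proof -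
  obtain a b c where abc: "x = of_int a" "y = of_int b" "z = of_int c"
    using assms(1-3) by (auto elim!: Ints_cases)
  have "norm_form x y z \<noteq> 0"
    using norm_form_int_eq_0[of a b c] nz by (auto simp: abc norm_form_of_int)
  with norm_form_nonneg[OF assms(4-6)] show ?thesis by simp
qed

text \<open>
  The induction step multiplies \<open>a + b\<theta> + c\<theta>\<^sup>2\<close> by the unit \<open>1 + \<theta> + \<theta>\<^sup>2\<close>, which keeps the norm.
\<close>

lemma norm_one_unbounded:
  "\<exists>a b c :: int. norm_form a b c = 1 \<and> a > int n \<and> b > 0 \<and> c > 0"
proof (induction n)
  case 0
  show ?case by (intro exI[of _ 1]) (simp add: norm_form_def)
next
  case (Suc n)
  then obtain a b c :: int
    where abc: "norm_form a b c = 1" "a > int n" "b > 0" "c > 0" by blast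
  have "norm_form (a + 2 * b + 2 * c) (a + b + 2 * c) (a + b + c) = norm_form a b c"
    by (simp add: norm_form_def algebra_simps power3_eq_cube)
  then have "norm_form (a + 2 * b + 2 * c) (a + b + 2 * c) (a + b + c) = 1"
    using abc(1) by simp
  with abc(2-4) show ?case
    by (intro exI[of _ "a + 2 * b + 2 * c"] exI[of _ "a + b + 2 * c"] exI[of _ "a + b + c"]) simp
qed

section \<open>Rays with several integer points\<close>

lemma bdd_below_cubic:
  fixes c3 c2 c1 c0 :: real
  assumes "c3 > 0"
  shows "bdd_below ((\<lambda>t. c3 * t ^ 3 + c2 * t ^ 2 + c1 * t + c0) ` {0..})"
proof -
  \<comment> \<open>Beyond \<open>T\<close> the cubic term outweighs the quadratic and the linear one.\<close>
  define T where "T = (\<bar>c2\<bar> + \<bar>c1\<bar>) / c3 + 1"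
  have T: "T \<ge> 1" using assms by (simp add: T_def)
  have "- \<bar>c2\<bar> * T ^ 2 - \<bar>c1\<bar> * T + c0 \<le> c3 * t ^ 3 + c2 * t ^ 2 + c1 * t + c0"
    if t: "t \<ge> 0" for t
  proof (cases "t \<le> T")
    case True
    have "c2 * t ^ 2 \<ge> - \<bar>c2\<bar> * t ^ 2" by (intro mult_right_mono) auto
    moreover have "\<bar>c2\<bar> * t ^ 2 \<le> \<bar>c2\<bar> * T ^ 2"
      using True t by (intro mult_left_mono power_mono) auto
    moreover have "c1 * t \<ge> - \<bar>c1\<bar> * t" using t by (intro mult_right_mono) auto
    moreover have "\<bar>c1\<bar> * t \<le> \<bar>c1\<bar> * T" using True by (intro mult_left_mono) auto
    moreover have "c3 * t ^ 3 \<ge> 0" using assms t by simp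
    ultimately show ?thesis by linarith
  next
    case False
    then have t1: "t \<ge> 1" using T by simp
    have "\<bar>c2\<bar> + \<bar>c1\<bar> \<le> c3 * t"
      using False assms by (simp add: T_def field_simps)
    then have "(\<bar>c2\<bar> + \<bar>c1\<bar>) * t ^ 2 \<le> c3 * t * t ^ 2"
      by (intro mult_right_mono) auto
    then have "\<bar>c2\<bar> * t ^ 2 + \<bar>c1\<bar> * t ^ 2 \<le> c3 * t ^ 3"
      by (simp add: algebra_simps power2_eq_square power3_eq_cube)
    moreover have "c2 * t ^ 2 \<ge> - \<bar>c2\<bar> * t ^ 2" by (intro mult_right_mono) auto
    moreover have "c1 * t \<ge> - \<bar>c1\<bar> * t" using t by (intro mult_right_mono) auto
    moreover have "\<bar>c1\<bar> * t \<le> \<bar>c1\<bar> * t ^ 2"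
      using t1 by (intro mult_left_mono) (auto simp: power2_eq_square)
    moreover have "\<bar>c2\<bar> * T ^ 2 \<ge> 0" "\<bar>c1\<bar> * T \<ge> 0" using T by auto
    ultimately show ?thesis by linarith
  qed
  then show ?thesis by (intro bdd_belowI2[where m = "- \<bar>c2\<bar> * T ^ 2 - \<bar>c1\<bar> * T + c0"]) auto
qed

lemma ray_in_orthant_direction_nonneg:
  fixes y d :: "real ^ 'n"
  assumes "ray y d \<subseteq> {x. \<forall>i. x $ i \<ge> 0}"
  shows "d $ i \<ge> 0"
proof (rule ccontr)
  assume "\<not> ?thesis"
  then have neg: "d $ i < 0" by simp
  define t where "t = (\<bar>y $ i\<bar> + 1) / - (d $ i)"
  have "t \<ge> 0" using neg by (simp add: t_def divide_nonneg_neg)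
  then have "y + t *\<^sub>R d \<in> ray y d" unfolding ray_def by blast
  with assms have "0 \<le> y $ i + t * d $ i" by fastforce
  moreover have "t * d $ i = - (\<bar>y $ i\<bar> + 1)" using neg by (simp add: t_def)
  ultimately show False by linarith
qed

text \<open>The difference of two integer points of a ray is a multiple of its direction.\<close>

lemma integral_direction_of_ray:
  fixes y d :: "real ^ 'n"
  assumes "\<not> finite (ray y d \<inter> integer_points)"
  obtains s where "s > 0" "s *\<^sub>R d \<in> integer_points"
proof -
  obtain p where p: "p \<in> ray y d \<inter> integer_points"
    using assms by (metis finite.emptyI equals0I)
  then obtain q where q: "q \<in> ray y d \<inter> integer_points" "q \<noteq> p"
    using assms finite_subset[of "ray y d \<inter> integer_points" "{p}"] by blast
  obtain t u where tu: "p = y + t *\<^sub>R d" "q = y + u *\<^sub>R d"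
    using p q by (auto simp: ray_def)
  have "(t - u) *\<^sub>R d = p - q" "(u - t) *\<^sub>R d = q - p"
    by (simp_all add: tu algebra_simps)
  moreover have "p - q \<in> integer_points" "q - p \<in> integer_points"
    using p q by (auto simp: integer_points_def)
  moreover have "t - u > 0 \<or> u - t > 0" using q tu by force
  ultimately show ?thesis using that by metis
qed

lemma norm_form_direction_pos:
  fixes y d :: "real ^ 3"
  assumes "d \<noteq> 0" and sub: "ray y d \<subseteq> {x. \<forall>i. x $ i \<ge> 0}"
    and inf: "\<not> finite (ray y d \<inter> integer_points)"
  shows "norm_form (d $ 1) (d $ 2) (d $ 3) > 0"
proof -
  obtain s where s: "s > 0" "s *\<^sub>R d \<in> integer_points"
    using integral_direction_of_ray[OF inf] .
  have "d $ 1 \<noteq> 0 \<or> d $ 2 \<noteq> 0 \<or> d $ 3 \<noteq> 0"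
    using \<open>d \<noteq> 0\<close> by (auto simp: vec_eq_iff forall_3)
  then have "norm_form (s * d $ 1) (s * d $ 2) (s * d $ 3) > 0"
    using s ray_in_orthant_direction_nonneg[OF sub]
    by (intro norm_form_pos) (auto simp: integer_points_def)
  then show ?thesis
    using s(1) by (simp add: norm_form_scale zero_less_mult_iff)
qed

lemma bdd_below_on_ray:
  fixes y d :: "real ^ 3"
  assumes "norm_form (d $ 1) (d $ 2) (d $ 3) > 0"
  shows "bdd_below ((\<lambda>x. norm_form (x $ 1) (x $ 2) (x $ 3) - x $ 1) ` ray y d)"
proof -
  \<comment> \<open>The Taylor coefficients at \<open>t = 0\<close> of the polynomial restricted to the ray.\<close>
  define c2 where "c2 = 3 * y $ 1 * (d $ 1)^2 + 6 * y $ 2 * (d $ 2)^2 + 12 * y $ 3 * (d $ 3)^2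
    - 6 * (y $ 1 * d $ 2 * d $ 3 + d $ 1 * y $ 2 * d $ 3 + d $ 1 * d $ 2 * y $ 3)"
  define c1 where "c1 = 3 * (y $ 1)^2 * d $ 1 + 6 * (y $ 2)^2 * d $ 2 + 12 * (y $ 3)^2 * d $ 3
    - 6 * (y $ 1 * y $ 2 * d $ 3 + y $ 1 * d $ 2 * y $ 3 + d $ 1 * y $ 2 * y $ 3) - d $ 1"
  define c0 where "c0 = norm_form (y $ 1) (y $ 2) (y $ 3) - y $ 1"
  have "norm_form (x $ 1) (x $ 2) (x $ 3) - x $ 1
      = norm_form (d $ 1) (d $ 2) (d $ 3) * t ^ 3 + c2 * t ^ 2 + c1 * t + c0"
    if "x = y + t *\<^sub>R d" for x t
    by (simp add: that norm_form_def c2_def c1_def c0_def algebra_simps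
        power2_eq_square power3_eq_cube)
  then have "(\<lambda>x. norm_form (x $ 1) (x $ 2) (x $ 3) - x $ 1) ` ray y d
      \<subseteq> (\<lambda>t. norm_form (d $ 1) (d $ 2) (d $ 3) * t ^ 3 + c2 * t ^ 2 + c1 * t + c0) ` {0..}"
    by (fastforce simp: ray_def)
  then show ?thesis by (rule bdd_below_mono[OF bdd_below_cubic[OF assms]])
qed

section \<open>The polynomial\<close>

lemma mpoly_eval_superset:
  fixes p :: "'n::finite real_mpoly"
  assumes "finite S" "Poly_Mapping.keys p \<subseteq> S"
  shows "mpoly_eval p x =
    (\<Sum>e\<in>S. Poly_Mapping.lookup p e * (\<Prod>i\<in>UNIV. x $ i ^ Poly_Mapping.lookup e i))"
  unfolding mpoly_eval_def
  using assms by (intro sum.mono_neutral_left) (auto simp: in_keys_iff)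

lemma mpoly_eval_add:
  fixes p q :: "'n::finite real_mpoly"
  shows "mpoly_eval (p + q) x = mpoly_eval p x + mpoly_eval q x"
proof -
  let ?S = "Poly_Mapping.keys p \<union> Poly_Mapping.keys q"
  have "Poly_Mapping.keys (p + q) \<subseteq> ?S" by (rule Poly_Mapping.keys_add)
  then show ?thesis
    by (subst (1 2 3) mpoly_eval_superset[of ?S])
       (auto simp: lookup_add algebra_simps sum.distrib)
qed

lemma mpoly_eval_single:
  fixes e :: "'n::finite \<Rightarrow>\<^sub>0 nat"
  shows "mpoly_eval (Poly_Mapping.single e c) x =
    c * (\<Prod>i\<in>UNIV. x $ i ^ Poly_Mapping.lookup e i)"
  by (subst mpoly_eval_superset[of "{e}"]) auto

definition monom3 :: "nat \<Rightarrow> nat \<Rightarrow> nat \<Rightarrow> 3 \<Rightarrow>\<^sub>0 nat" where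
  "monom3 i j k = Poly_Mapping.single 1 i + Poly_Mapping.single 2 j + Poly_Mapping.single 3 k"

lemma lookup_monom3:
  "Poly_Mapping.lookup (monom3 i j k) 1 = i"
  "Poly_Mapping.lookup (monom3 i j k) 2 = j"
  "Poly_Mapping.lookup (monom3 i j k) 3 = k"
  by (simp_all add: monom3_def lookup_add lookup_single when_def)

lemma monom3_eq_iff: "monom3 i j k = monom3 i' j' k' \<longleftrightarrow> i = i' \<and> j = j' \<and> k = k'"
proof
  assume "monom3 i j k = monom3 i' j' k'"
  then have "Poly_Mapping.lookup (monom3 i j k) n = Poly_Mapping.lookup (monom3 i' j' k') n" for n
    by simp
  from this[of 1] this[of 2] this[of 3] show "i = i' \<and> j = j' \<and> k = k'"
    by (simp add: lookup_monom3)
qed simp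

lemma sum_lookup_monom3: "sum (Poly_Mapping.lookup (monom3 i j k)) UNIV = i + j + k"
  by (simp only: sum_3 lookup_monom3)

lemma prod_UNIV_3: "prod f (UNIV :: 3 set) = f 1 * f 2 * (f 3 :: 'a :: comm_monoid_mult)"
  unfolding UNIV_3 by (simp add: ac_simps)

definition norm_poly :: "3 real_mpoly" where
  "norm_poly = Poly_Mapping.single (monom3 3 0 0) 1 + Poly_Mapping.single (monom3 0 3 0) 2
     + Poly_Mapping.single (monom3 0 0 3) 4 + Poly_Mapping.single (monom3 1 1 1) (- 6)
     + Poly_Mapping.single (monom3 1 0 0) (- 1)"

lemma mpoly_eval_norm_poly:
  "mpoly_eval norm_poly x = norm_form (x $ 1) (x $ 2) (x $ 3) - x $ 1"
  unfolding norm_poly_def mpoly_eval_add mpoly_eval_single prod_UNIV_3 lookup_monom3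
  by (simp add: norm_form_def)

lemma rational_coeffs_norm_poly: "rational_coeffs norm_poly"
proof -
  have "Poly_Mapping.lookup (Poly_Mapping.single e' c) e \<in> \<rat>" if "c \<in> \<rat>"
    for e e' :: "3 \<Rightarrow>\<^sub>0 nat" and c :: real
    using that by (simp add: lookup_single when_def)
  then show ?thesis
    unfolding rational_coeffs_def norm_poly_def lookup_add by (intro allI Rats_add) auto
qed

lemma total_degree_norm_poly: "mpoly_total_degree norm_poly = 3"
proof -
  let ?S = "{monom3 3 0 0, monom3 0 3 0, monom3 0 0 3, monom3 1 1 1, monom3 1 0 0}"
  let ?deg = "\<lambda>e :: 3 \<Rightarrow>\<^sub>0 nat. \<Sum>i\<in>UNIV. Poly_Mapping.lookup e i"
  have "Poly_Mapping.lookup norm_poly e = 0" if "e \<notin> ?S" for e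
    using that by (simp add: norm_poly_def lookup_add lookup_single when_def eq_commute[of e] del: One_nat_def)
  then have keys: "Poly_Mapping.keys norm_poly \<subseteq> ?S"
    unfolding in_keys_iff subset_iff by blast
  have "Poly_Mapping.lookup norm_poly (monom3 3 0 0) = 1"
    by (simp add: norm_poly_def lookup_add lookup_single monom3_eq_iff)
  then have top: "monom3 3 0 0 \<in> Poly_Mapping.keys norm_poly"
    by (simp add: in_keys_iff)
  have "?deg e \<le> 3" if "e \<in> ?S" for e
    using that by (auto simp: sum_lookup_monom3)
  then have "mpoly_total_degree norm_poly \<le> 3"
    using keys unfolding mpoly_total_degree_def by (intro Max.boundedI) auto
  moreover have "?deg (monom3 3 0 0) \<le> mpoly_total_degree norm_poly"
    unfolding mpoly_total_degree_def using top by (intro Max_ge) auto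
  then have "3 \<le> mpoly_total_degree norm_poly"
    by (simp add: sum_lookup_monom3)
  ultimately show ?thesis by simp
qed

section \<open>The example\<close>

lemma rational_polyhedron_orthant: "rational_polyhedron {x :: real ^ 3. \<forall>i. x $ i \<ge> 0}"
proof -
  define A :: "nat \<Rightarrow> real ^ 3" where "A i = - axis (of_nat i) 1" for i
  have sum: "(\<Sum>j\<in>UNIV. A i $ j * x $ j) = - x $ of_nat i" for i x
    by (simp add: A_def axis_def if_distrib if_distribR sum_negf cong: if_cong)
  have "A i $ j \<in> \<rat>" for i j by (simp add: A_def axis_def)
  moreover have "(\<forall>i. x $ i \<ge> 0) \<longleftrightarrow> (\<forall>i<3. x $ of_nat i \<ge> 0)" for x :: "real ^ 3"
  proof -
    have "{..<3::nat} = {0, 1, 2}" by auto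
    then have "(\<forall>i<3::nat. x $ of_nat i \<ge> 0) \<longleftrightarrow> (\<forall>i\<in>{0, 1, 2 :: nat}. x $ of_nat i \<ge> 0)"
      by (metis lessThan_iff)
    \<comment> \<open>The index type has exactly three elements, so its \<open>3\<close> and \<open>0\<close> coincide.\<close>
    moreover have "(3 :: 3) = 0" by simp
    then have "x $ 3 = x $ 0" by (rule arg_cong)
    ultimately show ?thesis by (auto simp only: forall_3 ball_simps of_nat_0 of_nat_1 of_nat_numeral)
  qed
  ultimately show ?thesis
    unfolding rational_polyhedron_def
    by (intro exI[of _ "3::nat"] exI[of _ A] exI[of _ "\<lambda>_. 0"]) (simp add: sum)
qed

theorem proposition1:
  "\<exists>(P :: (real ^ 3) set) (p :: 3 real_mpoly).
     rational_polyhedron P \<and>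
     rational_coeffs p \<and>
     mpoly_total_degree p = 3 \<and>
     \<not> bdd_below (mpoly_eval p ` (P \<inter> integer_points)) \<and>
     (\<forall>y d. d \<noteq> 0 \<and> ray y d \<subseteq> P \<longrightarrow>
        bdd_below (mpoly_eval p ` (ray y d \<inter> integer_points)))"
proof -
  define P :: "(real ^ 3) set" where "P = {x. \<forall>i. x $ i \<ge> 0}"
  have "\<exists>x\<in>P \<inter> integer_points. mpoly_eval norm_poly x < r" for r
  proof -
    obtain n :: nat where n: "real n > 1 - r" using reals_Archimedean2 by blast
    obtain a b c :: int
      where abc: "norm_form a b c = 1" "a > int n" "b > 0" "c > 0"
      using norm_one_unbounded by blast
    define x :: "real ^ 3" where "x = vector [of_int a, of_int b, of_int c]"
    have "x \<in> P \<inter> integer_points"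
      using abc by (simp add: x_def P_def integer_points_def forall_3)
    moreover have "mpoly_eval norm_poly x = 1 - of_int a"
      by (simp add: mpoly_eval_norm_poly x_def norm_form_of_int abc(1))
    moreover have "real_of_int a > real n" using abc(2) by linarith
    ultimately show ?thesis using n by force
  qed
  then have "\<not> bdd_below (mpoly_eval norm_poly ` (P \<inter> integer_points))"
    by (simp add: not_bdd_below_image_iff)
  moreover have "bdd_below (mpoly_eval norm_poly ` (ray y d \<inter> integer_points))"
    if "d \<noteq> 0" "ray y d \<subseteq> P" for y d
  proof (cases "finite (ray y d \<inter> integer_points)")
    case True
    then show ?thesis by simp
  next
    case False
    then have "norm_form (d $ 1) (d $ 2) (d $ 3) > 0"
      using that by (intro norm_form_direction_pos) (auto simp: P_def)
    from bdd_below_on_ray[OF this] have "bdd_below (mpoly_eval norm_poly ` ray y d)"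
      by (simp add: mpoly_eval_norm_poly)
    then show ?thesis by (rule bdd_below_mono) auto
  qed
  ultimately show ?thesis
    using rational_polyhedron_orthant rational_coeffs_norm_poly total_degree_norm_poly
    unfolding P_def by (intro exI[of _ "{x. \<forall>i. x $ i \<ge> 0}"] exI[of _ norm_poly]) simp
qed

end
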